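(* Let $n\ge 71$ and let $G_n=K_2\,\square\,K_n$. Then $\Gamma(G_n\times G_n)=n^2=\Gamma(G_n)^2$.
   Context: $K_m\,\square\,K_n$ is the Cartesian product (rook graph): vertex set $V(K_m)\times V(K_n)$, with $(u,u')$ adjacent to $(v,v')$ iff either $u=v$ and $u'\ne v'$, or $u\ne v$ and $u'=v'$. The direct product $G\times H$ has vertex set $V(G)\times V(H)$, with $(u_G,u_H)$ adjacent to $(v_G,v_H)$ iff $u_Gv_G\in E(G)$ and $u_Hv_H\in E(H)$. A set $D$ is dominating if every vertex is in $D$ or adjacent to a vertex of $D$; it is minimal dominating if no proper subset is dominating. The upper domination number $\Gamma(G)$ is the maximum size of a minimal dominating set of $G$. *)

theory Defs
  imports "Graph_Theory.Graph_Theory"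
begin

text \<open>
  A finite simple graph is a \<^locale>\<open>pair_graph\<close>: a finite, loop-free digraph without parallel
  arcs whose arc relation is symmetric.
\<close>

definition cartesian_product ::
    "'a pair_pre_digraph \<Rightarrow> 'b pair_pre_digraph \<Rightarrow> ('a \<times> 'b) pair_pre_digraph" (infixr \<open>\<box>\<^sub>G\<close> 70) where
  "G \<box>\<^sub>G H = \<lparr>
     pverts = pverts G \<times> pverts H,
     parcs = {((u, u'), (v, v')).
       u \<in> pverts G \<and> u = v \<and> (u', v') \<in> parcs H \<or>
       (u, v) \<in> parcs G \<and> u' \<in> pverts H \<and> u' = v'} \<rparr>"

definition direct_product ::
    "'a pair_pre_digraph \<Rightarrow> 'b pair_pre_digraph \<Rightarrow> ('a \<times> 'b) pair_pre_digraph" (infixr \<open>\<times>\<^sub>G\<close> 70) where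
  "G \<times>\<^sub>G H = \<lparr>
     pverts = pverts G \<times> pverts H,
     parcs = {((u, u'), (v, v')). (u, v) \<in> parcs G \<and> (u', v') \<in> parcs H} \<rparr>"

definition dominating_set :: "'a pair_pre_digraph \<Rightarrow> 'a set \<Rightarrow> bool" where
  "dominating_set G D \<longleftrightarrow>
     D \<subseteq> pverts G \<and> (\<forall>v \<in> pverts G. v \<in> D \<or> (\<exists>u \<in> D. (u, v) \<in> parcs G))"

definition minimal_dominating_set :: "'a pair_pre_digraph \<Rightarrow> 'a set \<Rightarrow> bool" where
  "minimal_dominating_set G D \<longleftrightarrow>
     dominating_set G D \<and> (\<forall>D'. D' \<subset> D \<longrightarrow> \<not> dominating_set G D')"

definition upper_domination_number :: "'a pair_pre_digraph \<Rightarrow> nat" where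
  "upper_domination_number G = Max {card D | D. minimal_dominating_set G D}"

lemma pair_graph_cartesian_product:
  assumes "pair_graph G" "pair_graph H"
  shows "pair_graph (G \<box>\<^sub>G H)"
proof -
  interpret G: pair_graph G by fact
  interpret H: pair_graph H by fact
  have sub: "parcs (G \<box>\<^sub>G H) \<subseteq> pverts (G \<box>\<^sub>G H) \<times> pverts (G \<box>\<^sub>G H)"
    by (auto simp: cartesian_product_def dest: G.wellformed' H.wellformed')
  have fin: "finite (pverts (G \<box>\<^sub>G H))"
    by (simp add: cartesian_product_def G.pair_finite_verts H.pair_finite_verts)
  have "sym (parcs G)" "sym (parcs H)"
    using G.pair_sym_arcs H.pair_sym_arcs by (auto simp: symmetric_def)
  then have sym: "sym (parcs (G \<box>\<^sub>G H))"
    unfolding sym_def by (auto simp: cartesian_product_def)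
  have "e \<in> parcs (G \<box>\<^sub>G H) \<Longrightarrow> fst e \<noteq> snd e" for e
    using G.pair_no_loops H.pair_no_loops by (fastforce simp: cartesian_product_def)
  with sub fin sym finite_subset[OF sub] show ?thesis
    by unfold_locales (auto simp: symmetric_def)
qed

lemma pair_graph_direct_product:
  assumes "pair_graph G" "pair_graph H"
  shows "pair_graph (G \<times>\<^sub>G H)"
proof -
  interpret G: pair_graph G by fact
  interpret H: pair_graph H by fact
  have sub: "parcs (G \<times>\<^sub>G H) \<subseteq> pverts (G \<times>\<^sub>G H) \<times> pverts (G \<times>\<^sub>G H)"
    by (auto simp: direct_product_def dest: G.wellformed' H.wellformed')
  have fin: "finite (pverts (G \<times>\<^sub>G H))"
    by (simp add: direct_product_def G.pair_finite_verts H.pair_finite_verts)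
  have "sym (parcs G)" "sym (parcs H)"
    using G.pair_sym_arcs H.pair_sym_arcs by (auto simp: symmetric_def)
  then have sym: "sym (parcs (G \<times>\<^sub>G H))"
    unfolding sym_def by (auto simp: direct_product_def)
  have "e \<in> parcs (G \<times>\<^sub>G H) \<Longrightarrow> fst e \<noteq> snd e" for e
    using G.pair_no_loops H.pair_no_loops by (fastforce simp: direct_product_def)
  with sub fin sym finite_subset[OF sub] show ?thesis
    by unfold_locales (auto simp: symmetric_def)
qed

lemma rook_graph_adjacency:
  assumes "K\<^bsub>m\<^esub> (with_proj A)" "K\<^bsub>n\<^esub> (with_proj B)"
    and "(u, u') \<in> pverts (A \<box>\<^sub>G B)" "(v, v') \<in> pverts (A \<box>\<^sub>G B)"
  shows "((u, u'), (v, v')) \<in> parcs (A \<box>\<^sub>G B) \<longleftrightarrow> u = v \<and> u' \<noteq> v' \<or> u \<noteq> v \<and> u' = v'"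
  using assms by (auto simp: cartesian_product_def complete_digraph_pair_def)

lemma minimal_dominating_set_sizes:
  assumes "pair_graph G"
  shows "finite {card D | D. minimal_dominating_set G D}"
    and "{card D | D. minimal_dominating_set G D} \<noteq> {}"
proof -
  interpret pair_graph G by fact
  have "{card D | D. minimal_dominating_set G D} \<subseteq> card ` Pow (pverts G)"
    by (auto simp: minimal_dominating_set_def dominating_set_def)
  then show "finite {card D | D. minimal_dominating_set G D}"
    by (rule finite_subset) (simp add: pair_finite_verts)
  have "finite {D. dominating_set G D}"
    by (rule finite_subset[of _ "Pow (pverts G)"])
      (auto simp: dominating_set_def pair_finite_verts)
  moreover have "pverts G \<in> {D. dominating_set G D}"
    by (simp add: dominating_set_def)
  ultimately obtain D where "D \<in> {D. dominating_set G D}"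
      "\<forall>D' \<in> {D. dominating_set G D}. D' \<subseteq> D \<longrightarrow> D = D'"
    using finite_has_minimal[of "{D. dominating_set G D}"] by blast
  then have "minimal_dominating_set G D"
    by (auto simp: minimal_dominating_set_def)
  then show "{card D | D. minimal_dominating_set G D} \<noteq> {}"
    by blast
qed

end

theory Submission
  imports Defs
begin

text \<open>
  Label the vertices of the prism by a bit and an element of an \<open>n\<close>-set \<open>V\<close>. A minimal dominating
  set \<open>D\<close> of the square then splits into four quadrants \<open>Q a b \<subseteq> V \<times> V\<close>, and each vertex of \<open>D\<close> has a
  private neighbour: a vertex dominated by it and by no other vertex of \<open>D\<close>. If the quadrant
  \<open>(a, b)\<close> contains a private neighbour at \<open>(i, j)\<close>, then \<open>Q a b\<close> has at most one point outside the
  cross formed by row \<open>i\<close> and column \<open>j\<close>. So a quadrant of size at least \<open>3 n\<close> contains no private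
  neighbours at all.

  If no quadrant is that large, or just two opposite ones, then \<open>D\<close> has only linear size. Two large
  quadrants sharing a bit leave the other two empty and never both occupy much of one row, whence
  at most \<open>n\<^sup>2\<close> points. Finally suppose that \<open>Q a b\<close> is the only large quadrant and that
  \<open>D\<close> has more than \<open>n\<^sup>2\<close> points. The opposite quadrant is then empty, and \<open>Q a b\<close> is almost everything,
  so that only boundedly many of its rows and columns are sparse. A row meeting \<open>Q a (\<not> b)\<close> is
  sparse in \<open>Q a b\<close>, and empty there if \<open>Q a (\<not> b)\<close> has at least 8 points in it; in the latter
  case \<open>Q (\<not> a) b\<close> lies in that row. By symmetry one may assume that the columns of \<open>Q (\<not> a) b\<close> are
  short; then \<open>Q (\<not> a) b\<close> has bounded size, while a single column meeting it costs \<open>Q a b\<close> almost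
  \<open>n\<close> points.
\<close>

section \<open>Rows and columns of a relation\<close>

lemma card_eq_sum_card_rows:
  assumes "finite V" "S \<subseteq> V \<times> V"
  shows "card S = (\<Sum>i\<in>V. card (S `` {i}))"
proof -
  have "S = (SIGMA i:V. S `` {i})"
    using assms(2) by auto
  moreover have "\<forall>i\<in>V. finite (S `` {i})"
    using assms by (auto intro: finite_subset[of _ V])
  ultimately show ?thesis
    using assms(1) card_SigmaI by metis
qed

lemma card_row_le:
  assumes "finite V" "S \<subseteq> V \<times> V"
  shows "card (S `` {i}) \<le> card V"
  using assms by (intro card_mono) auto

lemma card_le_if_rows_le:
  assumes "finite V" "S \<subseteq> V \<times> V" "P \<subseteq> V" "\<And>i. i \<in> P \<Longrightarrow> card (S `` {i}) \<le> m"
    and "\<And>i. i \<notin> P \<Longrightarrow> S `` {i} = {}"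
  shows "card S \<le> m * card P"
proof -
  have "card S = (\<Sum>i\<in>V. card (S `` {i}))"
    using assms card_eq_sum_card_rows by blast
  also have "\<dots> = (\<Sum>i\<in>P. card (S `` {i}))"
    using assms by (intro sum.mono_neutral_right) auto
  also have "\<dots> \<le> (\<Sum>i\<in>P. m)"
    using assms by (intro sum_mono) auto
  finally show ?thesis by (simp add: mult.commute)
qed

lemma card_light_rows_le:
  assumes "finite V" "S \<subseteq> V \<times> V"
  shows "card {(i, j). (i, j) \<in> S \<and> card (S `` {i}) \<le> m} \<le> m * card V"
proof (rule card_le_if_rows_le[of V])
  fix i
  have "{(i, j). (i, j) \<in> S \<and> card (S `` {i}) \<le> m} `` {i} =
      (if card (S `` {i}) \<le> m then S `` {i} else {})"
    by auto
  then show "card ({(i, j). (i, j) \<in> S \<and> card (S `` {i}) \<le> m} `` {i}) \<le> m"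
    by simp
qed (use assms in auto)

lemma card_light_columns_le:
  assumes "finite V" "S \<subseteq> V \<times> V"
  shows "card {(i, j). (i, j) \<in> S \<and> card (S\<inverse> `` {j}) \<le> m} \<le> m * card V"
proof -
  let ?C = "{(i, j). (i, j) \<in> S\<inverse> \<and> card (S\<inverse> `` {i}) \<le> m}"
  have "{(i, j). (i, j) \<in> S \<and> card (S\<inverse> `` {j}) \<le> m} = ?C\<inverse>"
    by auto
  moreover have "card ?C \<le> m * card V"
    using assms by (intro card_light_rows_le) auto
  ultimately show ?thesis
    by (simp only: card_inverse)
qed

text \<open>Every row in \<open>P\<close> leaves at least \<open>card V - m\<close> places of
  \<open>V \<times> V\<close> empty.\<close>

lemma card_add_light_rows_le:
  assumes "finite V" "S \<subseteq> V \<times> V" "P \<subseteq> V" "\<And>i. i \<in> P \<Longrightarrow> card (S `` {i}) \<le> m"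
    and "m \<le> card V"
  shows "card S + card P * (card V - m) \<le> card V * card V"
proof -
  have "card S = (\<Sum>i\<in>V - P. card (S `` {i})) + (\<Sum>i\<in>P. card (S `` {i}))"
    using assms(1-3) card_eq_sum_card_rows[of V S] sum.subset_diff[of P V] by simp
  also have "\<dots> \<le> (\<Sum>i\<in>V - P. card V) + (\<Sum>i\<in>P. m)"
    using assms card_row_le by (intro add_mono sum_mono) auto
  finally have "card S + card P * (card V - m) \<le>
      card (V - P) * card V + (card P * m + card P * (card V - m))"
    by simp
  also have "card P * m + card P * (card V - m) = card P * card V"
    using assms(5) by (simp flip: add_mult_distrib2)
  also have "card (V - P) * card V + card P * card V = card V * card V"
    using assms(1,3) by (simp add: card_Diff_subset finite_subset card_mono flip: add_mult_distrib)
  finally show ?thesis .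
qed

definition cross :: "'b \<Rightarrow> 'b \<Rightarrow> ('b \<times> 'b) set" where
  "cross i j = {(k, l). k = i \<or> l = j}"

lemma cross_iff [simp]: "(k, l) \<in> cross i j \<longleftrightarrow> k = i \<or> l = j"
  by (simp add: cross_def)

lemma card_Int_cross_le:
  assumes "finite V" "S \<subseteq> V \<times> V"
  shows "card (S \<inter> cross i j) \<le> 2 * card V"
proof -
  have "card (S \<inter> cross i j) \<le> card ({i} \<times> V \<union> V \<times> {j})"
    using assms by (intro card_mono) (auto simp: cross_def)
  also have "\<dots> \<le> card V + card V"
    using card_Un_le[of "{i} \<times> V" "V \<times> {j}"] by (simp add: card_cartesian_product)
  finally show ?thesis by simp
qed

text \<open>A point off row \<open>i\<close> would have to lie in both columns \<open>j\<close> and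
  \<open>j'\<close>.\<close>

lemma subset_row_if_subset_crosses:
  assumes "j \<noteq> j'" "S \<subseteq> cross i j" "S \<subseteq> cross i j'"
  shows "S \<subseteq> {i} \<times> UNIV"
  using assms by (fastforce simp: cross_def)

section \<open>Counting the four quadrants\<close>

text \<open>
  Closed adjacency in the square of the prism: in each factor, exactly one of the two coordinates
  changes.
\<close>

definition covers :: "bool \<Rightarrow> bool \<Rightarrow> 'b \<Rightarrow> 'b \<Rightarrow> bool \<Rightarrow> bool \<Rightarrow> 'b \<Rightarrow> 'b \<Rightarrow> bool" where
  "covers a b i j c d k l \<longleftrightarrow>
     a = c \<and> b = d \<and> i = k \<and> j = l \<or> (a = c) \<noteq> (i = k) \<and> (b = d) \<noteq> (j = l)"

text \<open>This is irredundance of a vertex set in coordinates: \<open>Q a b\<close> collects the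
  index pairs of its vertices with bits \<open>a\<close> and \<open>b\<close>, and
  \<open>ex_private\<close> supplies a private neighbour \<open>(c, d, k, l)\<close>, possibly in
  another quadrant.\<close>

locale quadrants =
  fixes V :: "'b set" and n :: nat and Q :: "bool \<Rightarrow> bool \<Rightarrow> ('b \<times> 'b) set"
  assumes finite_V: "finite V" and card_V: "card V = n" and n_ge: "n \<ge> 71"
    and Q_subset: "\<And>a b. Q a b \<subseteq> V \<times> V"
    and ex_private: "\<And>a b i j. (i, j) \<in> Q a b \<Longrightarrow> \<exists>c d k l. \<forall>a' b' i' j'. (i', j') \<in> Q a' b' \<longrightarrow>
      (covers a' b' i' j' c d k l \<longleftrightarrow> a' = a \<and> b' = b \<and> i' = i \<and> j' = j)"
begin

abbreviation total :: nat where
  "total \<equiv> card (Q False False) + card (Q False True) + card (Q True False) + card (Q True True)"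

lemma total_eq: "total = card (Q a b) + card (Q a (\<not> b)) + card (Q (\<not> a) b) + card (Q (\<not> a) (\<not> b))"
  by (cases a; cases b) simp_all

lemma finite_Q: "finite (Q a b)"
  using Q_subset finite_V by (meson finite_SigmaI finite_subset)

lemma finite_row: "finite (Q a b `` {i})"
  using finite_Q by (simp add: finite_Image)

lemma finite_column: "finite ((Q a b)\<inverse> `` {i})"
  using finite_Q by (simp add: finite_Image)

text \<open>Exchanging the two factors of the product swaps bits and coordinates together, so that
  statements about columns can be read off from those about rows.\<close>

lemma transpose: "quadrants V n (\<lambda>a b. (Q b a)\<inverse>)"
proof
  fix a b i j
  assume "(i, j) \<in> (Q b a)\<inverse>"
  then obtain c d k l where "\<forall>a' b' i' j'. (i', j') \<in> Q a' b' \<longrightarrow>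
      (covers a' b' i' j' c d k l \<longleftrightarrow> a' = b \<and> b' = a \<and> i' = j \<and> j' = i)"
    using ex_private[of j i b a] by auto
  then have "\<forall>a' b' i' j'. (i', j') \<in> (Q b' a')\<inverse> \<longrightarrow>
      (covers a' b' i' j' d c l k \<longleftrightarrow> a' = a \<and> b' = b \<and> i' = i \<and> j' = j)"
    unfolding covers_def by (simp add: conj_ac) blast
  then show "\<exists>c d k l. \<forall>a' b' i' j'. (i', j') \<in> (Q b' a')\<inverse> \<longrightarrow>
      (covers a' b' i' j' c d k l \<longleftrightarrow> a' = a \<and> b' = b \<and> i' = i \<and> j' = j)"
    by blast
qed (use finite_V card_V n_ge Q_subset in auto)

text \<open>The cases distinguish the quadrant that contains the private neighbour of \<open>(i, j)\<close>.\<close>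

lemma private_cases:
  assumes "(i, j) \<in> Q a b"
  obtains
    (self) "Q a b \<subseteq> cross i j" "(Q a (\<not> b))\<inverse> `` {j} \<subseteq> {i}"
  | (same) i' j' where "i' \<noteq> i" "Q a b \<subseteq> insert (i, j) (cross i' j')"
  | (row) j' where "Q (\<not> a) b \<subseteq> cross i j'" "Q a b `` {i} \<subseteq> {j, j'}"
  | (column) i' where "Q a (\<not> b) \<subseteq> cross i' j" "(Q a b)\<inverse> `` {j} \<subseteq> {i, i'}"
  | (opposite) "Q (\<not> a) (\<not> b) \<subseteq> cross i j" "Q a (\<not> b) `` {i} \<subseteq> {j}" "(Q (\<not> a) b)\<inverse> `` {j} \<subseteq> {i}"
proof -
  obtain c d k l where
    *: "\<And>a' b' i' j'. (i', j') \<in> Q a' b' \<Longrightarrow>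
      covers a' b' i' j' c d k l \<longleftrightarrow> a' = a \<and> b' = b \<and> i' = i \<and> j' = j"
    using ex_private[OF assms] by blast
  have cov: "covers a b i j c d k l"
    using *[OF assms] by simp
  \<comment> \<open>Within its own quadrant the private neighbour \<open>(k, l)\<close> is covered
    by itself and by everything off its cross; from \<open>Q (\<not> c) d\<close> by row
    \<open>k\<close> except in column \<open>l\<close>; from \<open>Q c (\<not> d)\<close> by column
    \<open>l\<close> except in row \<open>k\<close>. None of these places may hold a point other
    than \<open>(i, j)\<close>.\<close>
  have 1: "x = k \<or> y = l \<or> c = a \<and> d = b \<and> x = i \<and> y = j" if "(x, y) \<in> Q c d" for x y
    using *[OF that] by (auto simp: covers_def)
  have 2: "y = l \<or> c \<noteq> a \<and> d = b \<and> y = j" if "(k, y) \<in> Q (\<not> c) d" for y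
    using *[OF that] by (auto simp: covers_def)
  have 3: "x = k \<or> c = a \<and> d \<noteq> b \<and> x = i" if "(x, l) \<in> Q c (\<not> d)" for x
    using *[OF that] by (auto simp: covers_def)
  have "c = a \<or> c = (\<not> a)" "d = b \<or> d = (\<not> b)"
    by auto
  then consider (same_quadrant) "c = a" "d = b" | (row_quadrant) "c = (\<not> a)" "d = b"
    | (column_quadrant) "c = a" "d = (\<not> b)" | (opposite_quadrant) "c = (\<not> a)" "d = (\<not> b)"
    by blast
  then show thesis
  proof cases
    case same_quadrant
    show thesis
    proof (cases "k = i \<and> l = j")
      case True
      then have "Q a b \<subseteq> cross i j" "(Q a (\<not> b))\<inverse> `` {j} \<subseteq> {i}"
        using 1 3 same_quadrant by fastforce+
      then show thesis by (rule self)
    next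
      case False
      then have "k \<noteq> i"
        using cov same_quadrant by (auto simp: covers_def)
      moreover have "Q a b \<subseteq> insert (i, j) (cross k l)"
        using 1 same_quadrant by fastforce
      ultimately show thesis by (rule same)
    qed
  next
    case row_quadrant
    then have "k = i" using cov by (auto simp: covers_def)
    then have "Q (\<not> a) b \<subseteq> cross i l" "Q a b `` {i} \<subseteq> {j, l}"
      using 1 2 row_quadrant by fastforce+
    then show thesis by (rule row)
  next
    case column_quadrant
    then have "l = j" using cov by (auto simp: covers_def)
    then have "Q a (\<not> b) \<subseteq> cross k j" "(Q a b)\<inverse> `` {j} \<subseteq> {i, k}"
      using 1 3 column_quadrant by fastforce+
    then show thesis by (rule column)
  next
    case opposite_quadrant
    then have "k = i" "l = j" using cov by (auto simp: covers_def)
    then have "Q (\<not> a) (\<not> b) \<subseteq> cross i j" "Q a (\<not> b) `` {i} \<subseteq> {j}" "(Q (\<not> a) b)\<inverse> `` {j} \<subseteq> {i}"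
      using 1 2 3 opposite_quadrant by fastforce+
    then show thesis by (rule opposite)
  qed
qed

text \<open>The threshold exceeds \<open>2 * n + 1\<close>, which bounds a cross with one extra
  point, and \<open>2 * n + (n - 2)\<close>, which bounds a quadrant with at most one row of three
  or more points.\<close>

definition large :: "bool \<Rightarrow> bool \<Rightarrow> bool" where
  "large a b \<longleftrightarrow> 3 * n \<le> card (Q a b)"

lemma large_transpose: "quadrants.large n (\<lambda>a b. (Q b a)\<inverse>) a b \<longleftrightarrow> large b a"
  by (simp add: quadrants.large_def[OF transpose] large_def)

lemma total_transpose: "quadrants.total (\<lambda>a b. (Q b a)\<inverse>) = total"
  by simp

lemma not_subset_cross:
  assumes "large a b"
  shows "\<not> Q a b \<subseteq> cross i j" "\<not> Q a b \<subseteq> insert v (cross i j)"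
proof -
  show *: "\<not> Q a b \<subseteq> insert v (cross i j)" for v
  proof
    assume "Q a b \<subseteq> insert v (cross i j)"
    then have "card (Q a b) \<le> card (insert v (Q a b \<inter> cross i j))"
      using finite_Q by (intro card_mono) auto
    also have "\<dots> \<le> Suc (card (Q a b \<inter> cross i j))"
      by (rule card_insert_le_m1) auto
    also have "\<dots> \<le> Suc (2 * n)"
      using card_Int_cross_le[OF finite_V Q_subset] card_V by simp
    finally show False
      using assms n_ge by (simp add: large_def)
  qed
  then show "\<not> Q a b \<subseteq> cross i j" by blast
qed

text \<open>The cases \<open>self\<close> and \<open>same\<close> would squeeze the large quadrant
  into a cross with one extra point.\<close>

lemma large_cases:
  assumes "large a b" "(i, j) \<in> Q a b"
  obtains
    (row) j' where "Q (\<not> a) b \<subseteq> cross i j'" "card (Q a b `` {i}) \<le> 2"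
  | (column) i' where "Q a (\<not> b) \<subseteq> cross i' j" "card ((Q a b)\<inverse> `` {j}) \<le> 2"
  | (opposite) "Q (\<not> a) (\<not> b) \<subseteq> cross i j" "Q a (\<not> b) `` {i} \<subseteq> {j}" "(Q (\<not> a) b)\<inverse> `` {j} \<subseteq> {i}"
proof -
  have two: "card X \<le> 2" if "X \<subseteq> {x, y}" for X :: "'b set" and x y
    using card_mono[OF _ that] card_insert_le_m1[of 2 "{y}" x] by simp
  from assms(2) show thesis
    by (cases rule: private_cases)
      (use not_subset_cross[OF assms(1)] two row column opposite in blast)+
qed

section \<open>Two large quadrants sharing a bit\<close>

lemma two_heavy_rows:
  assumes "large a b"
  obtains i i' where "i \<noteq> i'" "card (Q a b `` {i}) \<ge> 3" "card (Q a b `` {i'}) \<ge> 3"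
proof -
  let ?H = "{i \<in> V. card (Q a b `` {i}) \<ge> 3}"
  have "card ?H \<ge> 2"
  proof (rule ccontr)
    assume "\<not> card ?H \<ge> 2"
    then have H: "card ?H \<le> 1" by simp
    have "card (Q a b) = (\<Sum>i\<in>V. card (Q a b `` {i}))"
      by (rule card_eq_sum_card_rows[OF finite_V Q_subset])
    also have "\<dots> \<le> (\<Sum>i\<in>V. 2 + (if i \<in> ?H then n - 2 else 0))"
    proof (rule sum_mono)
      fix i
      assume "i \<in> V"
      then show "card (Q a b `` {i}) \<le> 2 + (if i \<in> ?H then n - 2 else 0)"
        using card_row_le[OF finite_V Q_subset, of a b i] card_V n_ge by (simp, arith)
    qed
    also have "\<dots> = 2 * n + card ?H * (n - 2)"
      using finite_V card_V by (simp add: sum.distrib sum.If_cases Int_def del: add_2_eq_Suc)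
    also have "\<dots> \<le> 2 * n + 1 * (n - 2)"
      using H by (intro add_mono mult_right_mono) auto
    finally show False
      using assms n_ge by (simp add: large_def)
  qed
  then have "\<not> card ?H \<le> Suc 0" by simp
  then obtain i i' where "i \<in> ?H" "i' \<in> ?H" "i \<noteq> i'"
    using card_le_Suc0_iff_eq[of ?H] finite_V by auto
  then show thesis using that by blast
qed

text \<open>Three points in row \<open>i\<close> exclude the case \<open>row\<close>, and the size
  of \<open>Q a (\<not> b)\<close> excludes \<open>column\<close>. So \<open>opposite\<close> holds
  for two points of the row in different columns, and the two crosses meet only in row
  \<open>i\<close>.\<close>

lemma heavy_row_of_large:
  assumes "large a b" "large a (\<not> b)" "card (Q a b `` {i}) \<ge> 3"
  shows "Q a (\<not> b) `` {i} = {}" "Q (\<not> a) (\<not> b) \<subseteq> {i} \<times> UNIV"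
proof -
  have "Q (\<not> a) (\<not> b) \<subseteq> cross i j \<and> Q a (\<not> b) `` {i} \<subseteq> {j}" if "(i, j) \<in> Q a b" for j
    using assms(1) that
    by (cases rule: large_cases) (use assms not_subset_cross[OF assms(2)] in auto)
  moreover have "\<not> card (Q a b `` {i}) \<le> Suc 0"
    using assms(3) by simp
  then obtain j j' where "(i, j) \<in> Q a b" "(i, j') \<in> Q a b" "j \<noteq> j'"
    using card_le_Suc0_iff_eq[OF finite_row] by auto
  ultimately show "Q a (\<not> b) `` {i} = {}" "Q (\<not> a) (\<not> b) \<subseteq> {i} \<times> UNIV"
    using subset_row_if_subset_crosses[of j j' "Q (\<not> a) (\<not> b)" i] by blast+
qed

text \<open>Two different heavy rows would both have to contain the opposite quadrant.\<close>

lemma opposite_empty_if_row_large: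
  assumes "large a b" "large a (\<not> b)"
  shows "Q (\<not> a) (\<not> b) = {}"
proof -
  obtain i i' where "i \<noteq> i'" "card (Q a b `` {i}) \<ge> 3" "card (Q a b `` {i'}) \<ge> 3"
    using assms(1) by (rule two_heavy_rows)
  then show ?thesis
    using heavy_row_of_large(2)[OF assms] by blast
qed

lemma card_rows_le:
  assumes "\<And>i. i \<in> V \<Longrightarrow> card (Q a b `` {i}) + card (Q a (\<not> b) `` {i}) \<le> n"
  shows "card (Q a b) + card (Q a (\<not> b)) \<le> n * n"
proof -
  have "card (Q a b) + card (Q a (\<not> b)) = (\<Sum>i\<in>V. card (Q a b `` {i}) + card (Q a (\<not> b) `` {i}))"
    using card_eq_sum_card_rows[OF finite_V Q_subset] by (simp add: sum.distrib)
  also have "\<dots> \<le> (\<Sum>i\<in>V. n)"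
    using assms by (rule sum_mono)
  finally show ?thesis by (simp add: card_V)
qed

text \<open>In each row, either one of the two large quadrants is empty or both have at most two
  points. The other two quadrants are opposite to large ones, hence empty.\<close>

lemma total_le_if_row_large:
  assumes "large a b" "large a (\<not> b)"
  shows "total \<le> n * n"
proof -
  have assms': "large a (\<not> \<not> b)" using assms(1) by simp
  have "card (Q a b `` {i}) + card (Q a (\<not> b) `` {i}) \<le> n" for i
  proof (cases "card (Q a b `` {i}) \<ge> 3 \<or> card (Q a (\<not> b) `` {i}) \<ge> 3")
    case True
    then have "Q a b `` {i} = {} \<or> Q a (\<not> b) `` {i} = {}"
      using heavy_row_of_large(1)[OF assms, of i] heavy_row_of_large(1)[OF assms(2) assms', of i]
      unfolding not_not by blast
    then show ?thesis
      using card_row_le[OF finite_V Q_subset, of a b i]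
        card_row_le[OF finite_V Q_subset, of a "\<not> b" i] card_V by fastforce
  next
    case False
    then show ?thesis using n_ge by linarith
  qed
  then have "card (Q a b) + card (Q a (\<not> b)) \<le> n * n"
    by (rule card_rows_le)
  moreover have "Q (\<not> a) (\<not> b) = {}" "Q (\<not> a) b = {}"
    using opposite_empty_if_row_large[OF assms] opposite_empty_if_row_large[OF assms(2) assms'] by simp_all
  ultimately show ?thesis
    using total_eq[of a b] by simp
qed

lemma total_le_if_column_large:
  assumes "large a b" "large (\<not> a) b"
  shows "total \<le> n * n"
  using quadrants.total_le_if_row_large[OF transpose, where a = b and b = a, unfolded large_transpose, OF assms]
  by (simp only: card_inverse add_ac)

section \<open>Points in sparse rows or columns\<close>

definition light :: "bool \<Rightarrow> bool \<Rightarrow> ('b \<times> 'b) set" where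
  "light a b = {(i, j). (i, j) \<in> Q a b \<and> (card (Q a b `` {i}) \<le> 2 \<or> card ((Q a b)\<inverse> `` {j}) \<le> 2)}"

lemma card_light_le: "card (light a b) \<le> 4 * n"
proof -
  let ?R = "{(i, j). (i, j) \<in> Q a b \<and> card (Q a b `` {i}) \<le> 2}"
  let ?C = "{(i, j). (i, j) \<in> Q a b \<and> card ((Q a b)\<inverse> `` {j}) \<le> 2}"
  have "light a b = ?R \<union> ?C"
    by (auto simp: light_def)
  then have "card (light a b) \<le> card ?R + card ?C"
    by (simp only: card_Un_le)
  then show ?thesis
    using card_light_rows_le[OF finite_V Q_subset[of a b], of 2]
      card_light_columns_le[OF finite_V Q_subset[of a b], of 2] card_V by linarith
qed

lemma finite_light: "finite (light a b)"
  using finite_Q by (rule rev_finite_subset) (auto simp: light_def)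

text \<open>By \<open>large_cases\<close>, a point that is not light falls under
  \<open>opposite\<close>, which would put the large quadrant \<open>Q (\<not> a) (\<not> b)\<close>
  inside a cross.\<close>

lemma card_le_if_opposite_large:
  assumes "large a b" "large (\<not> a) (\<not> b)"
  shows "card (Q a b) \<le> 4 * n"
proof -
  have "(i, j) \<in> light a b" if "(i, j) \<in> Q a b" for i j
    using assms(1) that
    by (cases rule: large_cases) (use that not_subset_cross[OF assms(2)] in \<open>auto simp: light_def\<close>)
  then have "Q a b \<subseteq> light a b" by auto
  then show ?thesis
    using card_mono[OF finite_light] card_light_le le_trans by blast
qed

text \<open>A point \<open>(k, l)\<close> of the opposite quadrant lies on the cross of every point
  of \<open>Q a b\<close> that is not light. Being on each other's cross is symmetric, so these
  points fill at most one cross, and \<open>4 * n + 2 * n\<close> bounds the quadrant.\<close>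

lemma opposite_empty_if_huge:
  assumes "large a b" "6 * n < card (Q a b)"
  shows "Q (\<not> a) (\<not> b) = {}"
proof (rule ccontr)
  assume "Q (\<not> a) (\<not> b) \<noteq> {}"
  then obtain k l where kl: "(k, l) \<in> Q (\<not> a) (\<not> b)" by auto
  have "(i, j) \<in> light a b \<union> (Q a b \<inter> cross k l)" if "(i, j) \<in> Q a b" for i j
    using assms(1) that
    by (cases rule: large_cases) (use that kl in \<open>auto simp: light_def\<close>)
  then have "Q a b \<subseteq> light a b \<union> (Q a b \<inter> cross k l)" by (simp add: subset_iff split_paired_all)
  then have "card (Q a b) \<le> card (light a b \<union> (Q a b \<inter> cross k l))"
    using finite_light finite_Q by (intro card_mono) auto
  also have "\<dots> \<le> card (light a b) + card (Q a b \<inter> cross k l)"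
    by (rule card_Un_le)
  also have "\<dots> \<le> 4 * n + 2 * n"
    using card_light_le card_Int_cross_le[OF finite_V Q_subset] card_V by (metis add_mono)
  finally show False using assms(2) by simp
qed

section \<open>One large quadrant that is almost full\<close>

lemma card_le_6_if_light_rows:
  assumes "n * n < card (Q a b) + 6 * n" "P \<subseteq> V" "\<And>i. i \<in> P \<Longrightarrow> card (Q a b `` {i}) \<le> 7"
  shows "card P \<le> 6"
proof (rule ccontr)
  assume "\<not> card P \<le> 6"
  \<comment> \<open>Seven such rows would cost \<open>Q a b\<close> at least
    \<open>7 * (n - 7)\<close> places, which is at least \<open>6 * n\<close> once \<open>n\<close>
    reaches 49.\<close>
  then have "7 * (n - 7) \<le> card P * (n - 7)" by (intro mult_right_mono) auto
  moreover have "card (Q a b) + card P * (n - 7) \<le> n * n"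
    using card_add_light_rows_le[OF finite_V Q_subset assms(2,3)] card_V n_ge by simp
  ultimately show False using assms(1) n_ge by linarith
qed

lemma card_le_6_if_light_columns:
  assumes "n * n < card (Q a b) + 6 * n" "P \<subseteq> V" "\<And>j. j \<in> P \<Longrightarrow> card ((Q a b)\<inverse> `` {j}) \<le> 7"
  shows "card P \<le> 6"
  using quadrants.card_le_6_if_light_rows[OF transpose, where a = b and b = a and P = P] assms by simp

definition light_columns :: "bool \<Rightarrow> bool \<Rightarrow> 'b set" where
  "light_columns a b = {j \<in> V. card ((Q a b)\<inverse> `` {j}) \<le> 2}"

lemma card_light_columns:
  assumes "n * n < card (Q a b) + 6 * n"
  shows "card (light_columns a b) \<le> 6"
  using assms by (rule card_le_6_if_light_columns) (auto simp: light_columns_def)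

lemma finite_light_columns: "finite (light_columns a b)"
  using finite_V by (simp add: light_columns_def)

text \<open>If the row has more than two points, each of them lies in a light column or falls under
  \<open>opposite\<close>; the latter forces its column to be that of a given point of
  \<open>Q a (\<not> b)\<close> in row \<open>i\<close>. This leaves 6 + 1 columns.\<close>

lemma card_row_le_if_met:
  assumes "large a b" "n * n < card (Q a b) + 6 * n" "Q a (\<not> b) `` {i} \<noteq> {}"
  shows "card (Q a b `` {i}) \<le> 7"
proof (cases "card (Q a b `` {i}) \<le> 2")
  case False
  obtain l where l: "(i, l) \<in> Q a (\<not> b)" using assms(3) by auto
  have "j \<in> insert l (light_columns a b)" if "(i, j) \<in> Q a b" for j
    using assms(1) that
    by (cases rule: large_cases) (use that l False Q_subset in \<open>auto simp: light_columns_def\<close>)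
  then have "Q a b `` {i} \<subseteq> insert l (light_columns a b)" by auto
  then have "card (Q a b `` {i}) \<le> card (insert l (light_columns a b))"
    using finite_light_columns by (intro card_mono) auto
  also have "\<dots> \<le> Suc (card (light_columns a b))"
    by (rule card_insert_le_m1) auto
  finally show ?thesis using card_light_columns[OF assms(2)] by simp
qed simp

lemma card_column_le_if_met:
  assumes "large a b" "n * n < card (Q a b) + 6 * n" "(Q (\<not> a) b)\<inverse> `` {j} \<noteq> {}"
  shows "card ((Q a b)\<inverse> `` {j}) \<le> 7"
  using quadrants.card_row_le_if_met[OF transpose, where a = b and b = a and i = j] assms
  unfolding large_transpose by simp

text \<open>Of eight points in the row, at most six lie in light columns of \<open>Q a b\<close>.
  The other two must fall under \<open>opposite\<close>, and having different columns they empty row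
  \<open>i\<close> of \<open>Q a b\<close> and confine \<open>Q (\<not> a) b\<close> to the common
  row of their crosses.\<close>

lemma heavy_row_of_neighbour:
  assumes "large a b" "n * n < card (Q a b) + 6 * n" "card (Q a (\<not> b) `` {i}) \<ge> 8"
  shows "Q a b `` {i} = {}" "Q (\<not> a) b \<subseteq> {i} \<times> UNIV"
proof -
  have *: "j \<in> light_columns a b \<or> Q (\<not> a) b \<subseteq> cross i j \<and> Q a b `` {i} \<subseteq> {j}"
    if "(i, j) \<in> Q a (\<not> b)" for j
    using that
  proof (cases rule: private_cases)
    case self
    then have "card ((Q a b)\<inverse> `` {j}) \<le> card {i}"
      by (intro card_mono) auto
    moreover have "j \<in> V"
      using that Q_subset[of a "\<not> b"] by blast
    ultimately show ?thesis by (simp add: light_columns_def)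
  next
    case (same i' j')
    then have "Q a (\<not> b) `` {i} \<subseteq> {j, j'}" by auto
    then have "card (Q a (\<not> b) `` {i}) \<le> card {j, j'}" by (intro card_mono) auto
    then show ?thesis using assms(3) by (simp add: card_insert_if split: if_splits)
  next
    case (row j')
    then have "card (Q a (\<not> b) `` {i}) \<le> card {j, j'}" by (intro card_mono) auto
    then show ?thesis using assms(3) by (simp add: card_insert_if split: if_splits)
  next
    case (column i')
    then show ?thesis using not_subset_cross[OF assms(1)] by simp
  next
    case opposite
    then show ?thesis by simp
  qed
  let ?X = "Q a (\<not> b) `` {i} - light_columns a b"
  have "8 - 6 \<le> card ?X"
    using diff_card_le_card_Diff[OF finite_light_columns, of "Q a (\<not> b) `` {i}" a b]
      assms(3) card_light_columns[OF assms(2)] by linarith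
  then have "\<not> card ?X \<le> Suc 0" by simp
  then obtain j j' where "j \<in> ?X" "j' \<in> ?X" "j \<noteq> j'"
    using card_le_Suc0_iff_eq[of ?X] finite_row by blast
  then show "Q a b `` {i} = {}" "Q (\<not> a) b \<subseteq> {i} \<times> UNIV"
    using *[of j] *[of j'] subset_row_if_subset_crosses[of j j' "Q (\<not> a) b" i] by blast+
qed

lemma total_le_if_light_columns:
  assumes "large a b" "n * n < card (Q a b) + 6 * n" "Q (\<not> a) (\<not> b) = {}"
    and light: "\<And>j. card ((Q (\<not> a) b)\<inverse> `` {j}) \<le> 7"
  shows "total \<le> n * n"
proof -
  let ?r = "\<lambda>i. card (Q a b `` {i}) + card (Q a (\<not> b) `` {i})"
  \<comment> \<open>A row meeting \<open>Q a (\<not> b)\<close> has at most 7 points of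
    \<open>Q a b\<close>, and none if it has 8 or more points of \<open>Q a (\<not> b)\<close>;
    otherwise 7 + 7 stays below \<open>n\<close>.\<close>
  have r: "?r i \<le> n" for i
  proof (cases "Q a (\<not> b) `` {i} = {}")
    case True
    then show ?thesis using card_row_le[OF finite_V Q_subset] card_V by simp
  next
    case False
    then have "card (Q a b `` {i}) \<le> 7"
      using card_row_le_if_met assms by blast
    then show ?thesis
      using heavy_row_of_neighbour(1)[OF assms(1,2), of i] n_ge
        card_row_le[OF finite_V Q_subset, of a "\<not> b" i] card_V
      by (cases "card (Q a (\<not> b) `` {i}) \<ge> 8") auto
  qed
  show ?thesis
  proof (cases "Q (\<not> a) b = {}")
    case True
    then show ?thesis
      using card_rows_le[of a b] r assms(3) total_eq[of a b] by simp
  next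
    case False
    then obtain j where j: "(Q (\<not> a) b)\<inverse> `` {j} \<noteq> {}" "j \<in> V"
      using Q_subset by blast
    \<comment> \<open>The rows in \<open>M\<close> and the columns in \<open>N\<close> are sparse in
      \<open>Q a b\<close>, so there are at most six of each. With at most 7 points per column,
      \<open>Q (\<not> a) b\<close> has at most 7 * 6 = 42 points.\<close>
    define M where "M = {i \<in> V. Q a (\<not> b) `` {i} \<noteq> {}}"
    define N where "N = {j \<in> V. (Q (\<not> a) b)\<inverse> `` {j} \<noteq> {}}"
    have M: "card M \<le> 6"
      using assms(2) by (rule card_le_6_if_light_rows)
        (use card_row_le_if_met[OF assms(1,2)] in \<open>auto simp: M_def\<close>)
    have N: "card N \<le> 6"
      using assms(2) by (rule card_le_6_if_light_columns)
        (use card_column_le_if_met[OF assms(1,2)] in \<open>auto simp: N_def\<close>)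
    have "card ((Q (\<not> a) b)\<inverse>) \<le> 7 * card N"
      using finite_V Q_subset light by (intro card_le_if_rows_le[of V]) (auto simp: N_def)
    then have Q': "card (Q (\<not> a) b) \<le> 42"
      using N by simp
    \<comment> \<open>A row outside \<open>Z\<close> avoids \<open>Q a (\<not> b)\<close> and misses
      column \<open>j\<close> in \<open>Q a b\<close>, so its bound improves by one. Since
      \<open>Z\<close> has at most 6 + 7 rows, the gain of \<open>n - 13\<close> pays for the 42
      points of \<open>Q (\<not> a) b\<close>.\<close>
    define Z where "Z = M \<union> (Q a b)\<inverse> `` {j}"
    have "card Z \<le> 13"
      using card_Un_le[of M "(Q a b)\<inverse> `` {j}"] M card_column_le_if_met[OF assms(1,2) j(1)]
      by (simp add: Z_def)
    moreover have "finite Z" "Z \<subseteq> V"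
      using finite_V finite_column Q_subset[of a b] by (auto simp: Z_def M_def)
    ultimately have VZ: "card (V - Z) \<ge> n - 13"
      using card_Diff_subset[of Z V] card_V by simp
    have "?r i + (if i \<in> V - Z then 1 else 0) \<le> n" for i
    proof (cases "i \<in> V - Z")
      case True
      then have "Q a (\<not> b) `` {i} = {}" "Q a b `` {i} \<subseteq> V - {j}"
        using Q_subset by (auto simp: Z_def M_def)
      moreover from this have "card (Q a b `` {i}) \<le> card (V - {j})"
        using finite_V by (intro card_mono) auto
      ultimately show ?thesis
        using True j(2) finite_V card_V n_ge by simp
    qed (use r in auto)
    then have "(\<Sum>i\<in>V. ?r i + (if i \<in> V - Z then 1 else 0)) \<le> (\<Sum>i\<in>V. n)"
      by (rule sum_mono)
    moreover have "(\<Sum>i\<in>V. if i \<in> V - Z then 1 else 0) = card (V - Z)"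
      using finite_V by (simp add: sum.If_cases Int_def set_diff_eq)
    ultimately have "card (Q a b) + card (Q a (\<not> b)) + card (V - Z) \<le> n * n"
      using card_eq_sum_card_rows[OF finite_V Q_subset] card_V by (simp add: sum.distrib)
    then show ?thesis
      using VZ Q' n_ge assms(3) total_eq[of a b] by simp
  qed
qed

section \<open>Combining the cases into the upper bound\<close>

lemma total_le_if_large:
  assumes "large a b"
  shows "total \<le> n * n"
proof -
  have nn: "71 * n \<le> n * n" by (rule mult_right_mono[OF n_ge]) simp
  consider "large a (\<not> b)" | "large (\<not> a) b" | "\<not> large a (\<not> b)" "\<not> large (\<not> a) b"
    by blast
  then show ?thesis
  proof cases
    case 1
    then show ?thesis using assms total_le_if_row_large by blast
  next
    case 2
    then show ?thesis using assms total_le_if_column_large by blast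
  next
    case 3
    then have small: "card (Q a (\<not> b)) < 3 * n" "card (Q (\<not> a) b) < 3 * n"
      by (auto simp: large_def)
    show ?thesis
    proof (cases "large (\<not> a) (\<not> b)")
      case True
      \<comment> \<open>Two opposite large quadrants hold at most \<open>4 * n\<close> points each
        and the other two fewer than \<open>3 * n\<close> each, in all fewer than
        \<open>14 * n\<close>.\<close>
      then show ?thesis
        using card_le_if_opposite_large[of a b] card_le_if_opposite_large[of "\<not> a" "\<not> b"]
          assms small nn total_eq[of a b] unfolding not_not by linarith
    next
      case False
      show ?thesis
      proof (rule ccontr)
        assume gt: "\<not> total \<le> n * n"
        have opp_small: "card (Q (\<not> a) (\<not> b)) < 3 * n"
          using False by (simp add: large_def)
        have "6 * n < card (Q a b)"
          using gt opp_small small nn total_eq[of a b] by linarith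
        then have opp: "Q (\<not> a) (\<not> b) = {}"
          by (rule opposite_empty_if_huge[OF assms])
        then have "card (Q (\<not> a) (\<not> b)) = 0"
          by simp
        then have huge: "n * n < card (Q a b) + 6 * n"
          using gt small total_eq[of a b] by linarith
        \<comment> \<open>Exceeding \<open>n * n\<close> forces a column of
          \<open>Q (\<not> a) b\<close> and, by transposition, a row of
          \<open>Q a (\<not> b)\<close> with at least 8 points. Such a row confines
          \<open>Q (\<not> a) b\<close> to a single row, whose columns have at most one
          point.\<close>
        have "\<not> (\<forall>j. card ((Q (\<not> a) b)\<inverse> `` {j}) \<le> 7)"
          using total_le_if_light_columns[OF assms huge opp] gt by blast
        then obtain j where j: "\<not> card ((Q (\<not> a) b)\<inverse> `` {j}) \<le> 7" by blast
        have "\<not> (\<forall>i. card (Q a (\<not> b) `` {i}) \<le> 7)"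
          using quadrants.total_le_if_light_columns[OF transpose, where a = b and b = a] assms huge opp gt
          unfolding large_transpose total_transpose by auto
        then obtain i where "\<not> card (Q a (\<not> b) `` {i}) \<le> 7" by blast
        then have "card (Q a (\<not> b) `` {i}) \<ge> 8" by simp
        then have "Q (\<not> a) b \<subseteq> {i} \<times> UNIV"
          by (rule heavy_row_of_neighbour(2)[OF assms huge])
        then have "card ((Q (\<not> a) b)\<inverse> `` {j}) \<le> card {i}"
          by (intro card_mono) auto
        then show False using j by simp
      qed
    qed
  qed
qed

lemma total_le: "total \<le> n * n"
proof (cases "\<exists>a b. large a b")
  case True
  then show ?thesis using total_le_if_large by blast
next
  case False
  then have "card (Q a b) < 3 * n" for a b
    by (auto simp: large_def not_le)
  from this[of False False] this[of False True] this[of True False] this[of True True]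
  \<comment> \<open>Four quadrants below \<open>3 * n\<close> stay below \<open>12 * n\<close>; the
    weaker \<open>71 * n\<close> compares directly with \<open>n * n\<close>.\<close>
  have "total \<le> 71 * n" by linarith
  also have "\<dots> \<le> n * n" using n_ge by (intro mult_right_mono) auto
  finally show ?thesis .
qed

end


section \<open>Upper domination numbers\<close>

text \<open>A vertex missed by \<open>D - {v}\<close> is dominated by \<open>v\<close> alone.
  Conversely, a proper subset omits some \<open>v\<close> and leaves the private neighbour of
  \<open>v\<close> undominated.\<close>

lemma minimal_dominating_set_iff_private:
  "minimal_dominating_set G D \<longleftrightarrow> dominating_set G D \<and>
     (\<forall>v\<in>D. \<exists>w\<in>pverts G. \<forall>u\<in>D. u = w \<or> (u, w) \<in> parcs G \<longleftrightarrow> u = v)"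
proof safe
  assume D: "minimal_dominating_set G D"
  then show dom: "dominating_set G D"
    by (simp add: minimal_dominating_set_def)
  fix v
  assume "v \<in> D"
  then have "\<not> dominating_set G (D - {v})"
    using D by (auto simp: minimal_dominating_set_def)
  then obtain w where "w \<in> pverts G" "w \<notin> D - {v}" "\<forall>u\<in>D - {v}. (u, w) \<notin> parcs G"
    using dom by (auto simp: dominating_set_def)
  then show "\<exists>w\<in>pverts G. \<forall>u\<in>D. u = w \<or> (u, w) \<in> parcs G \<longleftrightarrow> u = v"
    using dom unfolding dominating_set_def by blast
next
  assume dom: "dominating_set G D"
    and priv: "\<forall>v\<in>D. \<exists>w\<in>pverts G. \<forall>u\<in>D. u = w \<or> (u, w) \<in> parcs G \<longleftrightarrow> u = v"
  have "\<not> dominating_set G D'" if "D' \<subset> D" for D'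
  proof -
    obtain v where v: "v \<in> D" "v \<notin> D'" using \<open>D' \<subset> D\<close> by blast
    then obtain w where w: "w \<in> pverts G" "\<forall>u\<in>D. u = w \<or> (u, w) \<in> parcs G \<longleftrightarrow> u = v"
      using priv by blast
    have "u \<noteq> w \<and> (u, w) \<notin> parcs G" if "u \<in> D'" for u
      using w(2) v that \<open>D' \<subset> D\<close> by (metis psubsetD)
    then show ?thesis
      using w(1) by (auto simp: dominating_set_def)
  qed
  then show "minimal_dominating_set G D"
    using dom by (simp add: minimal_dominating_set_def)
qed

lemma upper_domination_number_eqI:
  assumes "pair_graph G" "minimal_dominating_set G D"
    and "\<And>D'. minimal_dominating_set G D' \<Longrightarrow> card D' \<le> card D"
  shows "upper_domination_number G = card D"
  unfolding upper_domination_number_def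
proof (rule Max_eqI)
  show "finite {card D | D. minimal_dominating_set G D}"
    using assms(1) by (rule minimal_dominating_set_sizes)
qed (use assms in auto)

text \<open>The injection \<open>f\<close> names the two vertices of the factor of order two by
  bits, so that the other layer is reached by negation. Adjacency says that exactly one coordinate
  changes.\<close>

locale prism =
  fixes f :: "bool \<Rightarrow> 'a" and V :: "'b set" and n :: nat and G :: "('a \<times> 'b) pair_pre_digraph"
  assumes inj_f: "inj f" and finite_V: "finite V" and card_V: "card V = n" and n_ge: "n \<ge> 71"
    and pair_graph_G: "pair_graph G" and verts_G: "pverts G = range f \<times> V"
    and arcs_G: "((x, i), (y, j)) \<in> parcs G \<longleftrightarrow>
      x \<in> range f \<and> y \<in> range f \<and> i \<in> V \<and> j \<in> V \<and> (x = y) \<noteq> (i = j)"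
begin

lemma f_eq_iff [simp]: "f a = f b \<longleftrightarrow> a = b"
  using inj_f by (simp add: inj_eq)

lemma ex_other: "\<exists>k\<in>V. k \<noteq> i"
proof (rule ccontr)
  assume "\<not> (\<exists>k\<in>V. k \<noteq> i)"
  then have "card V \<le> card {i}" by (intro card_mono) auto
  then show False using card_V n_ge by simp
qed

text \<open>One layer attains the maximum: flipping the bit yields a private neighbour of each of
  its vertices.\<close>

lemma minimal_layer: "minimal_dominating_set G ({f False} \<times> V)"
  unfolding minimal_dominating_set_iff_private
proof safe
  have "v \<in> {f False} \<times> V \<or> (\<exists>u\<in>{f False} \<times> V. (u, v) \<in> parcs G)" if vert: "v \<in> pverts G" for v
  proof -
    obtain a i where "v = (f a, i)" "i \<in> V"
      using vert by (auto simp: verts_G)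
    then show ?thesis
      by (cases a) (auto simp: arcs_G)
  qed
  then show "dominating_set G ({f False} \<times> V)"
    unfolding dominating_set_def by (auto simp: verts_G)
  fix i
  assume "i \<in> V"
  then show "\<exists>w\<in>pverts G. \<forall>u\<in>{f False} \<times> V. u = w \<or> (u, w) \<in> parcs G \<longleftrightarrow> u = (f False, i)"
    by (intro bexI[of _ "(f True, i)"]) (auto simp: arcs_G verts_G)
qed

lemma card_le_if_minimal:
  assumes "minimal_dominating_set G D"
  shows "card D \<le> n"
proof -
  have D: "D \<subseteq> range f \<times> V"
    using assms by (auto simp: minimal_dominating_set_def dominating_set_def verts_G)
  define X where "X a = {i. (f a, i) \<in> D}" for a
  have X: "X a \<subseteq> V" for a using D by (auto simp: X_def)
  then have finX: "finite (X a)" for a using finite_V finite_subset by blast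
  \<comment> \<open>Each layer is complete, so \<open>i'\<close> already dominates all of layer
    \<open>a\<close>. The private neighbour of \<open>(f a, i)\<close> is thus in the other layer,
    where any point of \<open>D\<close> in that layer would dominate it.\<close>
  have other_empty: "X (\<not> a) = {}" if "i \<in> X a" "i' \<in> X a" "i \<noteq> i'" for a i i'
  proof (rule ccontr)
    assume "X (\<not> a) \<noteq> {}"
    then obtain k where k: "(f (\<not> a), k) \<in> D" by (auto simp: X_def)
    have i: "(f a, i) \<in> D" "(f a, i') \<in> D" using that by (auto simp: X_def)
    then obtain w where w: "w \<in> pverts G" "\<forall>u\<in>D. u = w \<or> (u, w) \<in> parcs G \<longleftrightarrow> u = (f a, i)"
      using assms unfolding minimal_dominating_set_iff_private by blast
    obtain c l where [simp]: "w = (f c, l)" "l \<in> V"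
      using w(1) by (auto simp: verts_G)
    have V: "i \<in> V" "i' \<in> V" "k \<in> V" using i k D by auto
    show False
      using w(2)[rule_format, OF i(1)] w(2)[rule_format, OF i(2)] w(2)[rule_format, OF k] V that(3)
      by (auto simp: arcs_G)
  qed
  have "D = Pair (f False) ` X False \<union> Pair (f True) ` X True"
  proof (intro equalityI subsetI)
    fix v
    assume "v \<in> D"
    moreover from this obtain a i where "v = (f a, i)" using D by auto
    ultimately show "v \<in> Pair (f False) ` X False \<union> Pair (f True) ` X True"
      by (cases a) (auto simp: X_def)
  qed (auto simp: X_def)
  then have "card D \<le> card (Pair (f False) ` X False) + card (Pair (f True) ` X True)"
    using card_Un_le by simp
  also have "\<dots> \<le> card (X False) + card (X True)"
    using finX by (intro add_mono card_image_le)
  also have "\<dots> \<le> n"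
  proof (cases "\<exists>a. card (X a) > Suc 0")
    case True
    then obtain a where "card (X a) > Suc 0" ..
    then have "X (\<not> a) = {}"
      using other_empty[of _ a] card_le_Suc0_iff_eq[OF finX, of a] by (meson not_le)
    moreover have "card (X a) \<le> n" using X finite_V card_V card_mono by blast
    ultimately show ?thesis by (cases a) auto
  next
    case False
    then have "card (X a) \<le> 1" for a by (simp add: not_less)
    from this[of False] this[of True] show ?thesis using n_ge by linarith
  qed
  finally show ?thesis .
qed

lemma upper_domination_number_prism: "upper_domination_number G = n"
  using upper_domination_number_eqI[OF pair_graph_G minimal_layer] card_le_if_minimal
  by (simp add: card_cartesian_product card_V)

section \<open>The direct product of the prism with itself\<close>

lemma verts_square: "pverts (G \<times>\<^sub>G G) = (range f \<times> V) \<times> (range f \<times> V)"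
  by (simp add: direct_product_def verts_G)

lemma covers_iff:
  assumes "i \<in> V" "j \<in> V" "k \<in> V" "l \<in> V"
  shows "((f a, i), (f b, j)) = ((f c, k), (f d, l)) \<or>
      (((f a, i), (f b, j)), ((f c, k), (f d, l))) \<in> parcs (G \<times>\<^sub>G G) \<longleftrightarrow>
    covers a b i j c d k l"
  using assms by (simp add: direct_product_def arcs_G covers_def rangeI conj_ac)

lemma minimal_layer_square:
  "minimal_dominating_set (G \<times>\<^sub>G G) (({f False} \<times> V) \<times> ({f False} \<times> V))" (is "minimal_dominating_set _ ?D")
  unfolding minimal_dominating_set_iff_private
proof (intro conjI ballI)
  \<comment> \<open>If exactly one bit differs, the dominating vertex keeps the coordinate next to
    that bit and must change the other one, which needs a second element of
    \<open>V\<close>.\<close>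
  have dom: "\<exists>k\<in>V. \<exists>l\<in>V. covers False False k l a b i j" if "i \<in> V" "j \<in> V" for a b i j
    using that ex_other[of i] ex_other[of j]
    by (cases a; cases b) (auto simp: covers_def)
  have "v \<in> ?D \<or> (\<exists>u\<in>?D. (u, v) \<in> parcs (G \<times>\<^sub>G G))" if vert: "v \<in> pverts (G \<times>\<^sub>G G)" for v
  proof -
    obtain a i b j where v: "v = ((f a, i), (f b, j))" "i \<in> V" "j \<in> V"
      using vert by (auto simp: verts_square)
    then obtain k l where kl: "k \<in> V" "l \<in> V" "covers False False k l a b i j"
      using dom by blast
    then have "((f False, k), (f False, l)) = v \<or> (((f False, k), (f False, l)), v) \<in> parcs (G \<times>\<^sub>G G)"
      using covers_iff[of k l i j False False a b] v by simp
    moreover have "((f False, k), (f False, l)) \<in> ?D"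
      using kl by simp
    ultimately show ?thesis by blast
  qed
  then show "dominating_set (G \<times>\<^sub>G G) ?D"
    unfolding dominating_set_def by (auto simp: verts_square)
  fix v
  assume "v \<in> ?D"
  then obtain i j where v: "v = ((f False, i), (f False, j))" "i \<in> V" "j \<in> V" by auto
  \<comment> \<open>With both bits flipped, neither index may change along an arc, so
    \<open>v\<close> is the only neighbour in the layer.\<close>
  let ?w = "((f True, i), (f True, j))"
  have "u = ?w \<or> (u, ?w) \<in> parcs (G \<times>\<^sub>G G) \<longleftrightarrow> u = v" if "u \<in> ?D" for u
    using that v by (auto simp: direct_product_def arcs_G rangeI)
  moreover have "?w \<in> pverts (G \<times>\<^sub>G G)"
    using v by (simp add: verts_square)
  ultimately show "\<exists>w\<in>pverts (G \<times>\<^sub>G G). \<forall>u\<in>?D. u = w \<or> (u, w) \<in> parcs (G \<times>\<^sub>G G) \<longleftrightarrow> u = v"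
    by (intro bexI[of _ ?w] ballI)
qed

lemma card_le_if_minimal_square:
  assumes "minimal_dominating_set (G \<times>\<^sub>G G) D"
  shows "card D \<le> n * n"
proof -
  have D: "D \<subseteq> (range f \<times> V) \<times> (range f \<times> V)"
    using assms by (auto simp: minimal_dominating_set_def dominating_set_def verts_square)
  define Q where "Q a b = {(i, j). ((f a, i), (f b, j)) \<in> D}" for a b
  interpret quadrants V n Q
  proof
    fix a b i j
    assume "(i, j) \<in> Q a b"
    then have "((f a, i), (f b, j)) \<in> D" by (simp add: Q_def)
    then obtain w where w: "w \<in> pverts (G \<times>\<^sub>G G)"
      "\<forall>u\<in>D. u = w \<or> (u, w) \<in> parcs (G \<times>\<^sub>G G) \<longleftrightarrow> u = ((f a, i), (f b, j))"
      using assms unfolding minimal_dominating_set_iff_private by blast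
    then obtain c d k l where kl: "w = ((f c, k), (f d, l))" "k \<in> V" "l \<in> V"
      by (auto simp: verts_square)
    have "covers a' b' i' j' c d k l \<longleftrightarrow> a' = a \<and> b' = b \<and> i' = i \<and> j' = j"
      if "(i', j') \<in> Q a' b'" for a' b' i' j'
    proof -
      have u: "((f a', i'), (f b', j')) \<in> D" using that by (simp add: Q_def)
      then have "i' \<in> V" "j' \<in> V" using D by auto
      then show ?thesis
        using w(2)[rule_format, OF u] covers_iff[of i' j' k l a' b' c d] kl by auto
    qed
    then show "\<exists>c d k l. \<forall>a' b' i' j'. (i', j') \<in> Q a' b' \<longrightarrow>
        (covers a' b' i' j' c d k l \<longleftrightarrow> a' = a \<and> b' = b \<and> i' = i \<and> j' = j)"
      by blast
  qed (use D finite_V card_V n_ge in \<open>auto simp: Q_def\<close>)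
  let ?g = "\<lambda>a b (i, j). ((f a, i), (f b, j))"
  have "D \<subseteq> ?g False False ` Q False False \<union> ?g False True ` Q False True \<union>
      ?g True False ` Q True False \<union> ?g True True ` Q True True"
  proof
    fix v
    assume "v \<in> D"
    moreover from this obtain a i b j where "v = ((f a, i), (f b, j))" using D by fast
    ultimately have "v \<in> ?g a b ` Q a b"
      by (auto simp: Q_def)
    then show "v \<in> ?g False False ` Q False False \<union> ?g False True ` Q False True \<union>
        ?g True False ` Q True False \<union> ?g True True ` Q True True"
      by (cases a; cases b) simp_all
  qed
  then have "card D \<le> card (?g False False ` Q False False \<union> ?g False True ` Q False True \<union>
      ?g True False ` Q True False \<union> ?g True True ` Q True True)"
    using finite_Q by (intro card_mono) auto
  also have "\<dots> \<le> card (?g False False ` Q False False) + card (?g False True ` Q False True) +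
      card (?g True False ` Q True False) + card (?g True True ` Q True True)"
    by (intro order_trans[OF card_Un_le] add_mono order_refl)
  also have "\<dots> \<le> total"
    using finite_Q by (intro add_mono card_image_le)
  also have "\<dots> \<le> n * n"
    by (rule total_le)
  finally show ?thesis .
qed

lemma upper_domination_number_square: "upper_domination_number (G \<times>\<^sub>G G) = n * n"
  using upper_domination_number_eqI[OF pair_graph_direct_product[OF pair_graph_G pair_graph_G]
      minimal_layer_square] card_le_if_minimal_square
  by (simp add: card_cartesian_product card_V)

end

theorem theorem16:
  fixes n :: nat
    and A :: "'a pair_pre_digraph" and B :: "'b pair_pre_digraph"
    and G :: "('a \<times> 'b) pair_pre_digraph"
  assumes "n \<ge> 71"
    and "K\<^bsub>2\<^esub> (with_proj A)" and "K\<^bsub>n\<^esub> (with_proj B)"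
    and "G = A \<box>\<^sub>G B"
  shows "upper_domination_number (G \<times>\<^sub>G G) = n\<^sup>2 \<and>
         n\<^sup>2 = (upper_domination_number G)\<^sup>2"
proof -
  obtain x y where xy: "pverts A = {x, y}" "x \<noteq> y"
    using assms(2) by (auto simp: complete_digraph_pair_def card_2_iff)
  define f where "f a = (if a then y else x)" for a
  have range_f: "range f = {x, y}"
    by (auto simp: f_def UNIV_bool)
  interpret prism f "pverts B" n G
  proof (rule prism.intro)
    show "inj f" using xy(2) by (auto simp: inj_def f_def)
    show "pair_graph G"
      unfolding assms(4) by (intro pair_graph_cartesian_product pair_graphI_complete[OF assms(2)]
          pair_graphI_complete[OF assms(3)])
    show "pverts G = range f \<times> pverts B"
      by (simp add: assms(4) cartesian_product_def range_f xy(1))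
    show "((x, i), (y, j)) \<in> parcs G \<longleftrightarrow> x \<in> range f \<and> y \<in> range f \<and> i \<in> pverts B \<and> j \<in> pverts B \<and>
        (x = y) \<noteq> (i = j)" for x y i j
      using assms(2,3) xy(1)[folded range_f]
      by (auto simp: assms(4) cartesian_product_def complete_digraph_pair_def)
  qed (use assms in \<open>auto simp: complete_digraph_pair_def\<close>)
  show ?thesis
    by (simp add: upper_domination_number_prism upper_domination_number_square power2_eq_square)
qed

end
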